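(* Let $N$ be a timelike ruled surface of type $N_-$ in $\mathbb{R}_1^3$ with timelike striction curve $\vec c$, curvatures $k_1,k_2$ and angle function $\theta$, and let $N^\beta$ be a $\beta$-transversal surface of $N$. Then $N^\beta$ is developable if and only if $$\tanh\theta=\frac{\beta'+k_2}{k_1\cos^2\beta}$$ holds on $I$.
   Context: $\mathbb{R}_1^3$ is Minkowski 3-space with metric $\langle\cdot,\cdot\rangle=-dx_1^2+dx_2^2+dx_3^2$. A nonzero vector $\vec v$ is timelike if $\langle\vec v,\vec v\rangle<0$, null if $\langle\vec v,\vec v\rangle=0$, spacelike if $\langle\vec v,\vec v\rangle>0$. Setting. All functions are smooth on an open interval $I$. A timelike ruled surface of type $N_-$ with timelike striction curve is $\vec r(s,v)=\vec c(s)+v\vec q(s)$, with ruling direction $\vec q$ unit timelike, where $\vec c$ is its striction curve, a timelike curve parametrized by arc length $s$. It has a Frenet frame $\{\vec q,\vec h,\vec a\}$ of mutually orthogonal vectors, $\langle\vec q,\vec q\rangle=-1$, $\langle\vec h,\vec h\rangle=\langle\vec a,\vec a\rangle=1$ ($\vec h$ is the central normal, i.e. the surface normal along $\vec c$; $\vec a$ the central tangent), with $\vec q\,'=k_1\vec h$, $\vec h'=k_1\vec q+k_2\vec a$, $\vec a'=-k_2\vec h$ (prime is $d/ds$) for functions $k_1,k_2$. Standing assumption: the derivatives of the frame vectors are non-null and $N$ is non-cylindrical; in particular $k_1\neq0$ and $k_1^2\neq k_2^2$ everywhere. The unit tangent of $\vec c$ is $\vec c\,'=\vec t=\cosh\theta\,\vec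 q+\sinh\theta\,\vec a$ for a real function $\theta$ (the hyperbolic angle between $\vec t$ and $\vec q$). $\beta$-transversal surface. For a function $\beta:I\to\mathbb{R}$ with $\beta(s)\neq n\pi,\ (2n+1)\pi/2$ for all $s\in I$, $n\in\mathbb{Z}$, $N^\beta$ is the ruled surface $\vec r_\beta(s,v)=\vec c(s)+v\vec q_\beta(s)$ with $\vec q_\beta=\cos\beta\,\vec h+\sin\beta\,\vec a$; it is assumed that $\langle\vec q_\beta',\vec q_\beta'\rangle\ne0$ everywhere. A ruled surface $\vec f(s)+v\vec p(s)$ with $\langle\vec p\,',\vec p\,'\rangle\ne0$ is developable if its distribution parameter $\det(\vec f\,',\vec p,\vec p\,')/\langle\vec p\,',\vec p\,'\rangle$ vanishes for all $s\in I$. *)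

theory Defs
  imports "HOL-Analysis.Analysis"
begin

text \<open>
  Minkowski 3-space is \<^typ>\<open>real ^ 3\<close> with the bilinear form below; the first coordinate is the
  time coordinate.
\<close>

definition mink :: "real ^ 3 \<Rightarrow> real ^ 3 \<Rightarrow> real"
  where "mink v w = - (v $ 1 * w $ 1) + v $ 2 * w $ 2 + v $ 3 * w $ 3"

text \<open>The zero vector has no causal character; in particular it is not null.\<close>

definition timelike :: "real ^ 3 \<Rightarrow> bool"
  where "timelike v \<longleftrightarrow> v \<noteq> 0 \<and> mink v v < 0"

definition null :: "real ^ 3 \<Rightarrow> bool"
  where "null v \<longleftrightarrow> v \<noteq> 0 \<and> mink v v = 0"

abbreviation vderiv :: "(real \<Rightarrow> 'a::real_normed_vector) \<Rightarrow> real \<Rightarrow> 'a"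
  where "vderiv f \<equiv> (\<lambda>s. vector_derivative f (at s))"

definition smooth_on :: "real set \<Rightarrow> (real \<Rightarrow> 'a::real_normed_vector) \<Rightarrow> bool"
  where "smooth_on I f \<longleftrightarrow> (\<forall>n. \<forall>s\<in>I. ((vderiv ^^ n) f) differentiable (at s))"

definition ruled_surface :: "(real \<Rightarrow> real ^ 3) \<Rightarrow> (real \<Rightarrow> real ^ 3) \<Rightarrow> real \<Rightarrow> real \<Rightarrow> real ^ 3"
  where "ruled_surface f p s v = f s + v *\<^sub>R p s"

text \<open>
  A parametrized surface is timelike if the form induced on its tangent planes is Lorentzian,
  that is, has negative Gram determinant. Ruled surfaces may have singular points, where there
  is no tangent plane; the condition is imposed at the regular points only.
\<close>

definition timelike_surface :: "real set \<Rightarrow> (real \<Rightarrow> real \<Rightarrow> real ^ 3) \<Rightarrow> bool"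
  where "timelike_surface I r \<longleftrightarrow>
    (\<forall>s\<in>I. \<forall>v.
      let rs = vderiv (\<lambda>s. r s v) s; rv = vderiv (\<lambda>v. r s v) v in
      cross3 rs rv \<noteq> 0 \<longrightarrow> mink rs rs * mink rv rv - (mink rs rv)\<^sup>2 < 0)"

definition striction_curve :: "real set \<Rightarrow> (real \<Rightarrow> real ^ 3) \<Rightarrow> (real \<Rightarrow> real ^ 3) \<Rightarrow> bool"
  where "striction_curve I f p \<longleftrightarrow> (\<forall>s\<in>I. mink (vderiv f s) (vderiv p s) = 0)"

definition noncylindrical :: "real set \<Rightarrow> (real \<Rightarrow> real ^ 3) \<Rightarrow> bool"
  where "noncylindrical I p \<longleftrightarrow> (\<forall>s\<in>I. vderiv p s \<noteq> 0)"

definition distribution_parameter :: "(real \<Rightarrow> real ^ 3) \<Rightarrow> (real \<Rightarrow> real ^ 3) \<Rightarrow> real \<Rightarrow> real"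
  where "distribution_parameter f p s =
    det (vector [vderiv f s, p s, vderiv p s] :: real ^ 3 ^ 3) / mink (vderiv p s) (vderiv p s)"

text \<open>Meaningful only for rulings with \<^term>\<open>mink (vderiv p s) (vderiv p s) \<noteq> 0\<close> on \<^term>\<open>I\<close>.\<close>

definition developable :: "real set \<Rightarrow> (real \<Rightarrow> real ^ 3) \<Rightarrow> (real \<Rightarrow> real ^ 3) \<Rightarrow> bool"
  where "developable I f p \<longleftrightarrow> (\<forall>s\<in>I. distribution_parameter f p s = 0)"

text \<open>
  A timelike ruled surface of type \<open>N_-\<close> with timelike striction curve \<open>c\<close> (parametrized by arc
  length), ruling \<open>q\<close>, Frenet frame \<open>q, h, a\<close>, curvatures \<open>k1, k2\<close>, and hyperbolic angle
  \<open>\<theta>\<close> between \<open>c'\<close> and \<open>q\<close>.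
\<close>

locale timelike_ruled_surface_N_minus =
  fixes I :: "real set"
    and c q h a :: "real \<Rightarrow> real ^ 3"
    and k1 k2 \<theta> :: "real \<Rightarrow> real"
  assumes interval: "open I" "is_interval I"
    and smooth: "smooth_on I c" "smooth_on I q" "smooth_on I h" "smooth_on I a"
      "smooth_on I k1" "smooth_on I k2" "smooth_on I \<theta>"
    and surface: "timelike_surface I (ruled_surface c q)"
    and striction: "striction_curve I c q"
    and timelike_curve: "\<And>s. s \<in> I \<Longrightarrow> timelike (vderiv c s)"
    and arc_length: "\<And>s. s \<in> I \<Longrightarrow> mink (vderiv c s) (vderiv c s) = -1"
    and frame_norms: "\<And>s. s \<in> I \<Longrightarrow> mink (q s) (q s) = -1"
      "\<And>s. s \<in> I \<Longrightarrow> mink (h s) (h s) = 1"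
      "\<And>s. s \<in> I \<Longrightarrow> mink (a s) (a s) = 1"
    and frame_orthogonal: "\<And>s. s \<in> I \<Longrightarrow> mink (q s) (h s) = 0"
      "\<And>s. s \<in> I \<Longrightarrow> mink (q s) (a s) = 0"
      "\<And>s. s \<in> I \<Longrightarrow> mink (h s) (a s) = 0"
    and central_normal: "\<And>s. s \<in> I \<Longrightarrow> mink (h s) (vderiv c s) = 0"
    and frenet: "\<And>s. s \<in> I \<Longrightarrow> vderiv q s = k1 s *\<^sub>R h s"
      "\<And>s. s \<in> I \<Longrightarrow> vderiv h s = k1 s *\<^sub>R q s + k2 s *\<^sub>R a s"
      "\<And>s. s \<in> I \<Longrightarrow> vderiv a s = - k2 s *\<^sub>R h s"
    and nonnull: "\<And>s. s \<in> I \<Longrightarrow> \<not> null (vderiv q s)"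
      "\<And>s. s \<in> I \<Longrightarrow> \<not> null (vderiv h s)"
      "\<And>s. s \<in> I \<Longrightarrow> \<not> null (vderiv a s)"
    and noncyl: "noncylindrical I q"
    and tangent: "\<And>s. s \<in> I \<Longrightarrow> vderiv c s = cosh (\<theta> s) *\<^sub>R q s + sinh (\<theta> s) *\<^sub>R a s"
begin

lemma k1_nonzero: "k1 s \<noteq> 0" if "s \<in> I"
  using noncyl frenet(1)[OF that] that by (auto simp: noncylindrical_def)

lemma k1_k2_squares_differ: "(k1 s)\<^sup>2 \<noteq> (k2 s)\<^sup>2" if "s \<in> I"
proof
  assume eq: "(k1 s)\<^sup>2 = (k2 s)\<^sup>2"
  have bilinear: "mink (x *\<^sub>R u + y *\<^sub>R w) (x *\<^sub>R u + y *\<^sub>R w)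
      = x\<^sup>2 * mink u u + 2 * x * y * mink u w + y\<^sup>2 * mink w w"
    "mink u (x *\<^sub>R u + y *\<^sub>R w) = x * mink u u + y * mink u w" for x y u w
    by (simp_all add: mink_def algebra_simps power2_eq_square)
  have "mink (vderiv h s) (vderiv h s) = 0"
    using eq by (simp add: frenet(2) that bilinear frame_norms frame_orthogonal)
  moreover have "mink (q s) (vderiv h s) = - k1 s"
    by (simp add: frenet(2) that bilinear frame_norms frame_orthogonal)
  hence "vderiv h s \<noteq> 0"
    using k1_nonzero[OF that] by (auto simp: mink_def)
  ultimately show False
    using nonnull(2)[OF that] by (simp add: null_def)
qed

end

definition transversal_ruling ::
    "(real \<Rightarrow> real) \<Rightarrow> (real \<Rightarrow> real ^ 3) \<Rightarrow> (real \<Rightarrow> real ^ 3) \<Rightarrow> real \<Rightarrow> real ^ 3"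
  where "transversal_ruling \<beta> h a s = cos (\<beta> s) *\<^sub>R h s + sin (\<beta> s) *\<^sub>R a s"

text \<open>
  The \<open>\<beta>\<close>-transversal surface is the ruled surface with base curve \<open>c\<close> and ruling
  \<^term>\<open>transversal_ruling \<beta> h a\<close>.
\<close>

locale transversal_surface = timelike_ruled_surface_N_minus +
  fixes \<beta> :: "real \<Rightarrow> real"
  assumes smooth_angle: "smooth_on I \<beta>"
    and angle: "\<And>s n. s \<in> I \<Longrightarrow> \<beta> s \<noteq> of_int n * pi"
      "\<And>s n. s \<in> I \<Longrightarrow> \<beta> s \<noteq> (2 * of_int n + 1) * pi / 2"
    and ruling_nonnull: "\<And>s. s \<in> I \<Longrightarrow>
      mink (vderiv (transversal_ruling \<beta> h a) s) (vderiv (transversal_ruling \<beta> h a) s) \<noteq> 0"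

end

theory Submission
  imports Defs
begin

text \<open>
  With \<open>w = \<beta>' + k2\<close>, the Frenet equations give the derivative of the transversal ruling the
  coordinates \<open>(k1 cos \<beta>, - w sin \<beta>, w cos \<beta>)\<close> in the frame \<open>q, h, a\<close>. So the numerator of the
  distribution parameter is \<open>w cosh \<theta> - k1 cos\<^sup>2 \<beta> sinh \<theta>\<close> times the determinant of the frame,
  whose square is 1 by the Gram determinant.
\<close>

text \<open>If M has rows u, v, w and J = diag(-1, 1, 1), the Gram matrix is M J M^T. The minus sign
  is det J = -1.\<close>

lemma det_squared_eq_minus_mink_gram:
  fixes u v w :: "real ^ 3"
  shows "(det (vector [u, v, w] :: real ^ 3 ^ 3))\<^sup>2 =
    - (det (vector [vector [mink u u, mink u v, mink u w],
                    vector [mink v u, mink v v, mink v w],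
                    vector [mink w u, mink w v, mink w w]] :: real ^ 3 ^ 3))"
  unfolding det_3 vector_3 mink_def by algebra

text \<open>Multiplicativity of det: the matrix on the left is the coefficient matrix times the
  matrix with rows u, v, w.\<close>

lemma det_vector3_combination:
  fixes u v w :: "real ^ 3"
  shows "det (vector [x1 *\<^sub>R u + y1 *\<^sub>R v + z1 *\<^sub>R w, x2 *\<^sub>R u + y2 *\<^sub>R v + z2 *\<^sub>R w,
      x3 *\<^sub>R u + y3 *\<^sub>R v + z3 *\<^sub>R w] :: real ^ 3 ^ 3) =
    det (vector [vector [x1, y1, z1], vector [x2, y2, z2], vector [x3, y3, z3]] :: real ^ 3 ^ 3) *
    det (vector [u, v, w] :: real ^ 3 ^ 3)"
  unfolding det_3 vector_3 vector_add_component vector_scaleR_component real_scaleR_def by algebra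

lemma smooth_on_imp_has_vector_derivative:
  assumes "smooth_on I f" "s \<in> I"
  shows "(f has_vector_derivative vderiv f s) (at s)"
  using assms vector_derivative_works
  unfolding smooth_on_def by (metis funpow_0)

context timelike_ruled_surface_N_minus
begin

lemma det_frame_nonzero:
  assumes "s \<in> I"
  shows "det (vector [q s, h s, a s] :: real ^ 3 ^ 3) \<noteq> 0"
proof -
  \<comment> \<open>The entries below the diagonal of the Gram matrix, which then becomes diag(-1,
    1, 1) with determinant -1.\<close>
  have "mink (h s) (q s) = 0" "mink (a s) (q s) = 0" "mink (a s) (h s) = 0"
    using frame_orthogonal[OF assms] by (simp_all add: mink_def mult.commute)
  then have "(det (vector [q s, h s, a s] :: real ^ 3 ^ 3))\<^sup>2 = 1"
    unfolding det_squared_eq_minus_mink_gram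
    by (simp add: det_3 frame_norms frame_orthogonal assms)
  then show ?thesis
    by auto
qed

end

context transversal_surface
begin

text \<open>Product rule. The frame itself turns at rate \<open>k2\<close> in the plane of
  \<open>h\<close> and \<open>a\<close>, which adds to the rate of \<beta>; the \<open>q\<close>
  component comes only from the derivative of \<open>h\<close>.\<close>

lemma vderiv_transversal_ruling:
  assumes "s \<in> I"
  shows "vderiv (transversal_ruling \<beta> h a) s =
    (k1 s * cos (\<beta> s)) *\<^sub>R q s + (- (deriv \<beta> s + k2 s) * sin (\<beta> s)) *\<^sub>R h s
      + ((deriv \<beta> s + k2 s) * cos (\<beta> s)) *\<^sub>R a s"
proof -
  \<comment> \<open>Smoothness is phrased with \<open>vderiv\<close>, while the formula uses
    \<open>deriv\<close>; for real functions the two agree.\<close>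
  have "(\<beta> has_vector_derivative vderiv \<beta> s) (at s)"
    using smooth_angle assms by (rule smooth_on_imp_has_vector_derivative)
  then have \<beta>: "(\<beta> has_real_derivative deriv \<beta> s) (at s)"
    using DERIV_imp_deriv has_real_derivative_iff_has_vector_derivative by metis
  have h: "(h has_vector_derivative k1 s *\<^sub>R q s + k2 s *\<^sub>R a s) (at s)"
    using smooth_on_imp_has_vector_derivative[OF smooth(3) assms] frenet(2)[OF assms] by simp
  have a: "(a has_vector_derivative - k2 s *\<^sub>R h s) (at s)"
    using smooth_on_imp_has_vector_derivative[OF smooth(4) assms] frenet(3)[OF assms] by simp
  have cos: "((\<lambda>s. cos (\<beta> s)) has_real_derivative - sin (\<beta> s) * deriv \<beta> s) (at s)"
    and sin: "((\<lambda>s. sin (\<beta> s)) has_real_derivative cos (\<beta> s) * deriv \<beta> s) (at s)"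
    using \<beta> by (auto intro!: derivative_eq_intros)
  have "(transversal_ruling \<beta> h a has_vector_derivative
      (cos (\<beta> s) *\<^sub>R (k1 s *\<^sub>R q s + k2 s *\<^sub>R a s) + (- sin (\<beta> s) * deriv \<beta> s) *\<^sub>R h s)
      + (sin (\<beta> s) *\<^sub>R (- k2 s *\<^sub>R h s) + (cos (\<beta> s) * deriv \<beta> s) *\<^sub>R a s)) (at s)"
    unfolding transversal_ruling_def[abs_def]
    by (intro has_vector_derivative_add has_vector_derivative_scaleR cos sin h a)
  then show ?thesis
    by (simp add: vector_derivative_at algebra_simps)
qed

text \<open>The excluded odd multiples of pi/2 are exactly the zeros of the cosine. This permits
  division by the squared cosine later.\<close>

lemma cos_angle_nonzero:
  assumes "s \<in> I"
  shows "cos (\<beta> s) \<noteq> 0"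
proof
  assume "cos (\<beta> s) = 0"
  then obtain n where "\<beta> s = of_int n * pi + pi / 2"
    unfolding cos_zero_iff_int2 by blast
  then have "\<beta> s = (2 * of_int n + 1) * pi / 2"
    by (simp add: field_simps)
  with angle(2)[OF assms] show False
    by blast
qed

lemma det_transversal:
  assumes "s \<in> I"
  shows "det (vector [vderiv c s, transversal_ruling \<beta> h a s,
      vderiv (transversal_ruling \<beta> h a) s] :: real ^ 3 ^ 3) =
    (cosh (\<theta> s) * (deriv \<beta> s + k2 s) - sinh (\<theta> s) * (k1 s * (cos (\<beta> s))\<^sup>2)) *
    det (vector [q s, h s, a s] :: real ^ 3 ^ 3)"
proof -
  \<comment> \<open>Zero coefficients are written out so that all three rows match
    \<open>det_vector3_combination\<close>.\<close>
  have c: "vderiv c s = cosh (\<theta> s) *\<^sub>R q s + 0 *\<^sub>R h s + sinh (\<theta> s) *\<^sub>R a s"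
    by (simp add: tangent assms)
  have p: "transversal_ruling \<beta> h a s = 0 *\<^sub>R q s + cos (\<beta> s) *\<^sub>R h s + sin (\<beta> s) *\<^sub>R a s"
    by (simp add: transversal_ruling_def)
  have "det (vector [vector [cosh (\<theta> s), 0, sinh (\<theta> s)], vector [0, cos (\<beta> s), sin (\<beta> s)],
      vector [k1 s * cos (\<beta> s), - (deriv \<beta> s + k2 s) * sin (\<beta> s),
        (deriv \<beta> s + k2 s) * cos (\<beta> s)]] :: real ^ 3 ^ 3) =
    cosh (\<theta> s) * (deriv \<beta> s + k2 s) - sinh (\<theta> s) * (k1 s * (cos (\<beta> s))\<^sup>2)"
    \<comment> \<open>The cofactor of the cosh entry is the derivative sum times cos^2 + sin^2,
      hence the Pythagorean identity.\<close>
    unfolding det_3 vector_3 using sin_cos_squared_add[of "\<beta> s"] by algebra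
  then show ?thesis
    unfolding c p vderiv_transversal_ruling[OF assms] det_vector3_combination by simp
qed

text \<open>A quotient with nonzero denominator vanishes iff its numerator does, and the frame
  determinant cancels. Cross-multiplying tanh = sinh/cosh turns the remaining factor into the stated
  equation.\<close>

lemma distribution_parameter_transversal_eq_0_iff:
  assumes "s \<in> I"
  shows "distribution_parameter c (transversal_ruling \<beta> h a) s = 0 \<longleftrightarrow>
    tanh (\<theta> s) = (deriv \<beta> s + k2 s) / (k1 s * (cos (\<beta> s))\<^sup>2)"
proof -
  have "k1 s * (cos (\<beta> s))\<^sup>2 \<noteq> 0"
    using k1_nonzero cos_angle_nonzero assms by simp
  moreover have "cosh (\<theta> s) \<noteq> 0"
    by simp
  ultimately have "tanh (\<theta> s) = (deriv \<beta> s + k2 s) / (k1 s * (cos (\<beta> s))\<^sup>2) \<longleftrightarrow>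
      cosh (\<theta> s) * (deriv \<beta> s + k2 s) - sinh (\<theta> s) * (k1 s * (cos (\<beta> s))\<^sup>2) = 0"
    unfolding tanh_def by (auto simp: frac_eq_eq mult.commute)
  then show ?thesis
    using ruling_nonnull[OF assms] det_frame_nonzero[OF assms]
    by (simp add: distribution_parameter_def det_transversal assms)
qed

end

theorem theorem5p5:
  fixes I :: "real set"
    and c q h a :: "real \<Rightarrow> real ^ 3"
    and k1 k2 \<theta> \<beta> :: "real \<Rightarrow> real"
  assumes "timelike_ruled_surface_N_minus I c q h a k1 k2 \<theta>"
    and "transversal_surface I c q h a k1 k2 \<theta> \<beta>"
  shows "developable I c (transversal_ruling \<beta> h a) \<longleftrightarrow>
    (\<forall>s\<in>I. tanh (\<theta> s) = (deriv \<beta> s + k2 s) / (k1 s * (cos (\<beta> s))\<^sup>2))"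
  using transversal_surface.distribution_parameter_transversal_eq_0_iff[OF assms(2)]
  by (simp add: developable_def)

end
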